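(* Every graph in $\varepsilon_{12}$ has a node of degree $2$.
   Context: All graphs are finite, simple and connected. An Euler graph is a connected graph all of whose nodes have even degree. A cycle of length $n$ is of type $i$ if $n\equiv i\pmod 4$. $\varepsilon_{12}$ is the class of Euler graphs in which every cycle has length $\equiv 1$ or $\equiv 2\pmod 4$ and which contain at least one cycle of each of the types $1$ and $2$. *)

theory Defs
  imports "Graph_Theory.Graph_Theory"
begin

text \<open>
  A finite simple graph is a \<^locale>\<open>graph\<close>: a finite symmetric digraph without loops and
  without parallel arcs, each undirected edge being a pair of opposite arcs. Hence the degree of a
  node is its \<^const>\<open>out_degree\<close>. The bound on the length excludes the closed walks
  \<open>u, v, u\<close> along a single undirected edge, which \<^const>\<open>pre_digraph.cycle\<close> admits.
\<close>

definition ucycle :: "('a, 'b) pre_digraph \<Rightarrow> 'b list \<Rightarrow> bool" where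
  "ucycle G p \<longleftrightarrow> pre_digraph.cycle G p \<and> 3 \<le> length p"

definition cycle_of_type :: "('a, 'b) pre_digraph \<Rightarrow> nat \<Rightarrow> 'b list \<Rightarrow> bool" where
  "cycle_of_type G i p \<longleftrightarrow> ucycle G p \<and> length p mod 4 = i mod 4"

definition euler_graph :: "('a, 'b) pre_digraph \<Rightarrow> bool" where
  "euler_graph G \<longleftrightarrow> graph G \<and> connected G \<and> (\<forall>v \<in> verts G. even (out_degree G v))"

definition epsilon12 :: "('a, 'b) pre_digraph set" where
  "epsilon12 = {G. euler_graph G
     \<and> (\<forall>p. ucycle G p \<longrightarrow> cycle_of_type G 1 p \<or> cycle_of_type G 2 p)
     \<and> (\<exists>p. cycle_of_type G 1 p)
     \<and> (\<exists>p. cycle_of_type G 2 p)}"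

end

theory Submission
  imports Defs
begin

text \<open>
  If all cycles have length 1 or 2 modulo 4, then no cycle has two crossing chords: the lengths of
  six cycles in the resulting subdivision of \<open>K\<^sub>4\<close> are incompatible modulo 4. On the other hand,
  minimum degree 3 forces crossing chords. Among the longest paths \<open>v\<^sub>0 \<dots> v\<^sub>k\<close> choose one where \<open>v\<^sub>0\<close>
  has a neighbour \<open>v\<^sub>a\<close> with \<open>a \<ge> 2\<close> least possible. All neighbours of \<open>v\<^sub>0\<close> lie on the path, so there
  is one, \<open>v\<^sub>b\<close>, with \<open>b > a\<close>. The rotated path \<open>v\<^bsub>a-1\<^esub> \<dots> v\<^sub>0 v\<^sub>a \<dots> v\<^sub>k\<close> is also longest, hence \<open>v\<^bsub>a-1\<^esub>\<close>
  has a neighbour \<open>v\<^sub>c\<close> with \<open>c > a\<close>. If \<open>c \<le> b\<close>, the chords \<open>v\<^sub>0v\<^sub>a\<close> and \<open>v\<^bsub>a-1\<^esub>v\<^sub>c\<close> cross in the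
  cycle \<open>v\<^sub>0 \<dots> v\<^sub>b\<close>; otherwise the same happens for the rotated path. So in an Euler graph with
  cycles of types 1 and 2 only, some node has degree less than 3.
\<close>

section \<open>Crossing chords and cycle lengths modulo 4\<close>

text \<open>Cycles are lists of nodes over a bare relation, so that cutting, reversing and rejoining
  them are list operations. The closing edge is not listed again, hence \<open>length zs\<close> is
  the number of edges.\<close>

definition vertex_cycle :: "('a \<Rightarrow> 'a \<Rightarrow> bool) \<Rightarrow> 'a list \<Rightarrow> bool" where
  "vertex_cycle E zs \<longleftrightarrow>
     distinct zs \<and> 3 \<le> length zs \<and> successively E zs \<and> E (last zs) (hd zs)"

lemma successively_rev_symp:
  assumes "symp E"
  shows "successively E (rev xs) \<longleftrightarrow> successively E xs"
proof -
  have "(\<lambda>x y. E y x) = E"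
    using assms by (auto simp: fun_eq_iff dest: sympD)
  then show ?thesis
    unfolding successively_rev by (rule arg_cong)
qed

text \<open>The first three conditions force P = 2 and R = 1 modulo 4. Then the fourth puts Q in {0,
  3} and the fifth puts it in {1, 2}.\<close>

lemma crossing_chords_mod_4:
  fixes P Q R :: nat
  assumes "(P + 3) mod 4 \<in> {1, 2}" "(R + 4) mod 4 \<in> {1, 2}" "(P + R + 3) mod 4 \<in> {1, 2}"
    "(P + Q + 4) mod 4 \<in> {1, 2}" "(Q + R + 3) mod 4 \<in> {1, 2}" "(P + Q + R + 4) mod 4 \<in> {1, 2}"
  shows False
proof -
  define i j k where "i = P mod 4" and "j = Q mod 4" and "k = R mod 4"
  have less: "i < 4" "j < 4" "k < 4"
    unfolding i_def j_def k_def by auto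
  have eqs: "(P + 3) mod 4 = (i + 3) mod 4" "(R + 4) mod 4 = (k + 4) mod 4"
    "(P + R + 3) mod 4 = (i + k + 3) mod 4" "(P + Q + 4) mod 4 = (i + j + 4) mod 4"
    "(Q + R + 3) mod 4 = (j + k + 3) mod 4" "(P + Q + R + 4) mod 4 = (i + j + k + 4) mod 4"
    unfolding i_def j_def k_def by (intro mod_add_cong; simp)+
  note cong = assms[unfolded eqs]
  have "i = 0 \<or> i = 1 \<or> i = 2 \<or> i = 3" "j = 0 \<or> j = 1 \<or> j = 2 \<or> j = 3"
    "k = 0 \<or> k = 1 \<or> k = 2 \<or> k = 3"
    using less by linarith+
  moreover from this(1) cong(1) have "i = 2 \<or> i = 3"
    by (elim disjE) simp_all
  moreover from calculation(3) cong(2) have "k = 1 \<or> k = 2"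
    by (elim disjE) simp_all
  ultimately show False
    using cong(3-6) by (elim disjE) simp_all
qed

text \<open>The chords join \<open>u\<close> to \<open>w\<close> and \<open>v\<close> to \<open>y\<close>; if \<open>r = []\<close>, the closing edge joins \<open>u\<close> to \<open>y\<close>.\<close>

lemma crossing_chords_cycle_mod_4:
  fixes E :: "'a \<Rightarrow> 'a \<Rightarrow> bool"
  assumes sym: "symp E"
    and path: "successively E ((u # p @ [v]) @ (w # q @ [y]) @ r)"
    and dist: "distinct ((u # p @ [v]) @ (w # q @ [y]) @ r)"
    and uw: "E u w" and vy: "E v y" and closing: "E u (last (y # r))"
  shows "\<exists>zs. vertex_cycle E zs \<and> length zs mod 4 \<notin> {1, 2}"
proof (rule ccontr)
  assume "\<not> ?thesis"
  then have type12: "n mod 4 \<in> {1, 2}" if "vertex_cycle E zs" "length zs = n" for zs n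
    using that by blast
  note [simp] = vertex_cycle_def successively_append_iff successively_Cons
    successively_rev_symp[OF sym] hd_append hd_rev last_rev
  note [simp del] = successively_rev
  have E_sym: "E b a" if "E a b" for a b
    using sym that by (rule sympD)
  have closing': "E (last (y # r)) u"
    using closing by (rule E_sym)
  \<comment> \<open>The branch nodes are \<open>u\<close>, \<open>v\<close>, \<open>w\<close>,
    \<open>y\<close>. Cycles 1, 5 and 6 avoid \<open>y\<close>, \<open>v\<close> and
    \<open>w\<close> respectively; cycles 2, 3 and 4 pass through all four.\<close>
  have "vertex_cycle E (u # p @ [v, w])"
    using path dist E_sym[OF uw] by auto
  note 1 = type12[OF this]
  have "vertex_cycle E (u # p @ v # w # q @ y # r)"
    using path dist closing' by (auto split: if_splits)
  note 2 = type12[OF this]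
  have "vertex_cycle E ((u # p @ [v]) @ rev (w # q @ [y]))"
    using path dist E_sym[OF uw] vy by (auto intro: E_sym split: if_splits)
  note 3 = type12[OF this]
  have "vertex_cycle E (u # w # v # y # r)"
    using path dist closing' uw vy by (auto intro: E_sym split: if_splits)
  note 4 = type12[OF this]
  have "vertex_cycle E (u # w # q @ y # r)"
    using path dist closing' uw by (auto split: if_splits)
  note 5 = type12[OF this]
  have "vertex_cycle E (u # p @ v # y # r)"
    using path dist closing' vy by (auto split: if_splits)
  note 6 = type12[OF this]
  show False
    by (rule crossing_chords_mod_4[of "length p" "length r" "length q", OF 1 4 6 3 5 2]; simp)
qed

text \<open>Here \<open>u\<close>, \<open>v\<close>, \<open>w\<close>, \<open>y\<close> sit at the
  positions 0, a - 1, a, c, and the chord from 0 to b closes the cycle. The bound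
  \<open>2 \<le> a\<close> keeps \<open>u\<close> and \<open>v\<close> apart; \<open>c = b\<close>
  gives \<open>r = []\<close>.\<close>

lemma crossing_chords_nth_cycle_mod_4:
  fixes E :: "'a \<Rightarrow> 'a \<Rightarrow> bool"
  assumes sym: "symp E" and path: "successively E xs" and dist: "distinct xs"
    and idx: "2 \<le> a" "a < c" "c \<le> b" "b < length xs"
    and chords: "E (xs ! 0) (xs ! a)" "E (xs ! (a - 1)) (xs ! c)" "E (xs ! 0) (xs ! b)"
  shows "\<exists>zs. vertex_cycle E zs \<and> length zs mod 4 \<notin> {1, 2}"
proof -
  have split: "\<exists>p. map f [i..<Suc j] = f i # p @ [f j]" if "i < j" for f :: "nat \<Rightarrow> 'a" and i j
  proof -
    have "[i..<Suc j] = i # [Suc i..<j] @ [j]"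
      using that by (simp add: upt_conv_Cons)
    then show ?thesis by simp
  qed
  obtain p where p: "map ((!) xs) [0..<a] = xs ! 0 # p @ [xs ! (a - 1)]"
    using split[of 0 "a - 1" "(!) xs"] idx by auto
  obtain q where q: "map ((!) xs) [a..<Suc c] = xs ! a # q @ [xs ! c]"
    using split[of a c "(!) xs"] idx by auto
  define r where "r = map ((!) xs) [Suc c..<Suc b]"
  have "take (Suc b) xs = map ((!) xs) [0..<Suc b]"
    using idx by (intro nth_equalityI) (auto simp del: upt_Suc)
  also have "[0..<Suc b] = [0..<a] @ [a..<Suc c] @ [Suc c..<Suc b]"
    using idx upt_add_eq_append[of 0 a "Suc b - a"] upt_add_eq_append[of a "Suc c" "b - c"]
    by (simp del: upt_Suc)
  finally have take: "take (Suc b) xs =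
      (xs ! 0 # p @ [xs ! (a - 1)]) @ (xs ! a # q @ [xs ! c]) @ r"
    by (simp only: map_append p q r_def)
  have "last (xs ! c # r) = xs ! b"
    using idx by (cases "c = b") (auto simp: r_def)
  moreover have "successively E (take (Suc b) xs)"
    using path by (metis append_take_drop_id successively_append_iff)
  moreover have "distinct (take (Suc b) xs)"
    using dist by simp
  ultimately show ?thesis
    using crossing_chords_cycle_mod_4[OF sym, of "xs ! 0" p "xs ! (a - 1)" "xs ! a" q "xs ! c" r]
      chords take by simp
qed

section \<open>Longest paths under minimum degree 3\<close>

lemma min_degree_3_cycle_mod_4:
  fixes E :: "'a \<Rightarrow> 'a \<Rightarrow> bool"
  assumes sym: "symp E" and irrefl: "irreflp E"
    and fin: "finite V" and nonempty: "V \<noteq> {}" and wf: "\<And>u v. E u v \<Longrightarrow> v \<in> V"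
    and deg: "\<And>u v w. u \<in> V \<Longrightarrow> \<exists>x. E u x \<and> x \<noteq> v \<and> x \<noteq> w"
  shows "\<exists>zs. vertex_cycle E zs \<and> length zs mod 4 \<notin> {1, 2}"
proof -
  define path where
    "path xs \<longleftrightarrow> xs \<noteq> [] \<and> set xs \<subseteq> V \<and> distinct xs \<and> successively E xs" for xs
  obtain s where "s \<in> V" using nonempty by auto
  then have "path [s]" by (simp add: path_def)
  moreover have "\<forall>xs. path xs \<longrightarrow> length xs \<le> card V"
    by (metis card_mono distinct_card fin path_def)
  ultimately obtain xs0 where xs0: "path xs0" and longest: "\<And>ys. path ys \<Longrightarrow> length ys \<le> length xs0"
    using ex_has_greatest_nat[of path "[s]" length "Suc (card V)"] by (auto simp: less_Suc_eq_le)
  define n where "n = length xs0"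
  have nbr: "\<exists>i. 2 \<le> i \<and> i \<noteq> a \<and> i < n \<and> E (xs ! 0) (xs ! i)"
    if xs: "path xs" "length xs = n" for xs a
  proof -
    have hd: "hd xs = xs ! 0" "xs ! 0 \<in> V"
      using xs(1) by (auto simp: path_def hd_conv_nth)
    \<comment> \<open>Avoiding \<open>xs ! 1\<close> and \<open>xs ! a\<close> excludes these
      positions on the path. An index beyond the end only excludes some arbitrary node, which does
      no harm.\<close>
    obtain v where v: "E (xs ! 0) v" "v \<noteq> xs ! 1" "v \<noteq> xs ! a"
      using deg[OF hd(2)] by blast
    have "v \<in> set xs"
    proof (rule ccontr)
      assume "v \<notin> set xs"
      then have "path (v # xs)"
        using xs(1) v(1) wf sympD[OF sym v(1)] hd by (auto simp: path_def successively_Cons)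
      then show False using longest[of "v # xs"] xs(2) by (simp add: n_def)
    qed
    then obtain i where i: "i < n" "v = xs ! i"
      using xs(2) by (auto simp: in_set_conv_nth)
    have "i \<noteq> 0"
    proof
      assume "i = 0"
      with i v irreflpD[OF irrefl, of v] show False by simp
    qed
    moreover have "i \<noteq> 1" "i \<noteq> a"
      using i v by auto
    ultimately have "2 \<le> i" "i \<noteq> a"
      by auto
    with i v show ?thesis by (intro exI[of _ i]) auto
  qed
  define short where "short a \<longleftrightarrow>
      (\<exists>xs. path xs \<and> length xs = n \<and> 2 \<le> a \<and> a < n \<and> E (xs ! 0) (xs ! a))" for a
  define a where "a = (LEAST a. short a)"
  have "\<exists>a. short a"
    using nbr[OF xs0, of 0] xs0 unfolding short_def n_def by blast
  then have "short a"
    unfolding a_def by (rule LeastI_ex)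
  then obtain xs where xs: "path xs" "length xs = n" "2 \<le> a" "a < n" "E (xs ! 0) (xs ! a)"
    unfolding short_def by blast
  \<comment> \<open>Since \<open>a\<close> is least over all longest paths, not just for
    \<open>xs\<close>, this also applies to the rotated path \<open>ys\<close>.\<close>
  have far: "\<exists>i>a. i < n \<and> E (ys ! 0) (ys ! i)" if ys: "path ys" "length ys = n" for ys
  proof -
    obtain i where i: "2 \<le> i" "i \<noteq> a" "i < n" "E (ys ! 0) (ys ! i)"
      using nbr[OF ys] by blast
    then have "a \<le> i"
      unfolding a_def using ys by (intro Least_le) (auto simp: short_def)
    with i show ?thesis by (intro exI[of _ i]) auto
  qed
  define ys where "ys = rev (take a xs) @ drop a xs"
  have ys_nth: "ys ! i = (if i < a then xs ! (a - 1 - i) else xs ! i)" if "i < n" for i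
    using that xs by (auto simp: ys_def nth_append rev_nth)
  have "path ys"
  proof -
    have *: "xs = take a xs @ drop a xs" by simp
    have "successively E (take a xs)" "successively E (drop a xs)"
      using xs(1) by (metis * path_def successively_append_iff)+
    moreover have "last (rev (take a xs)) = xs ! 0" "hd (drop a xs) = xs ! a"
      using xs by (auto simp: path_def last_rev hd_conv_nth hd_drop_conv_nth)
    ultimately have "successively E ys"
      unfolding ys_def using xs(5) by (simp add: successively_append_iff successively_rev_symp[OF sym]
      del: successively_rev)
    moreover have "set ys = set xs" "distinct ys"
      using xs(1) * unfolding ys_def path_def
      by (metis set_append set_rev, metis distinct_append distinct_rev set_rev)
    ultimately show ?thesis
      using xs(1) by (auto simp: path_def)
  qed
  have ys_len: "length ys = n"
    using xs by (simp add: ys_def)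
  obtain b where b: "a < b" "b < n" "E (xs ! 0) (xs ! b)"
    using far xs by blast
  obtain c where c: "a < c" "c < n" "E (ys ! 0) (ys ! c)"
    using far \<open>path ys\<close> ys_len by blast
  have ends: "ys ! 0 = xs ! (a - 1)" "ys ! (a - 1) = xs ! 0"
    "ys ! a = xs ! a" "ys ! b = xs ! b" "ys ! c = xs ! c"
    using ys_nth xs b c by auto
  have step: "E (xs ! (a - 1)) (xs ! a)"
    using successively_nth[of E xs "a - 1"] xs by (auto simp: path_def)
  show ?thesis
  proof (cases "c \<le> b")
    case True
    then show ?thesis
      using crossing_chords_nth_cycle_mod_4[OF sym, of xs a c b] xs b c ends by (auto simp: path_def)
  next
    \<comment> \<open>Now \<open>b < c\<close>, and in \<open>ys\<close> the roles swap: the former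
      path edge \<open>step\<close> is the chord from 0 to a, the old chord to b starts at position
      a - 1, and the chord to c closes the cycle.\<close>
    case False
    then show ?thesis
      using crossing_chords_nth_cycle_mod_4[OF sym, of ys a b c] \<open>path ys\<close> ys_len xs b c ends step
      by (auto simp: path_def)
  qed
qed

section \<open>From node lists to arc walks\<close>

lemma (in wf_digraph) successively_dominates_awalk:
  assumes "successively (\<lambda>u v. u \<rightarrow>\<^bsub>G\<^esub> v) zs" "zs \<noteq> []" "set zs \<subseteq> verts G"
  shows "\<exists>p. awalk (hd zs) p (last zs) \<and> awalk_verts (hd zs) p = zs"
  using assms
proof (induction zs)
  case (Cons z zs)
  show ?case
  proof (cases "zs = []")
    case True
    then show ?thesis using Cons.prems by (intro exI[of _ "[]"]) (auto simp: awalk_Nil_iff)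
  next
    case False
    then obtain p where p: "awalk (hd zs) p (last zs)" "awalk_verts (hd zs) p = zs"
      using Cons by (auto simp: successively_Cons)
    obtain e where e: "e \<in> arcs G" "tail G e = z" "head G e = hd zs"
      using Cons.prems False by (auto simp: successively_Cons arcs_ends_def arc_to_ends_def)
    then show ?thesis
      using p False by (intro exI[of _ "e # p"]) (auto simp: awalk_Cons_iff)
  qed
qed simp

lemma (in wf_digraph) vertex_cycle_ucycle:
  assumes "vertex_cycle (\<lambda>u v. u \<rightarrow>\<^bsub>G\<^esub> v) zs"
  shows "\<exists>p. ucycle G p \<and> length p = length zs"
proof -
  have zs: "distinct zs" "3 \<le> length zs" "zs \<noteq> []"
    using assms by (auto simp: vertex_cycle_def)
  \<comment> \<open>Repeating the first node at the end gives a closed walk with one arc per entry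
    of \<open>zs\<close>.\<close>
  have succ: "successively (\<lambda>u v. u \<rightarrow>\<^bsub>G\<^esub> v) (zs @ [hd zs])"
    using assms by (auto simp: vertex_cycle_def successively_append_iff)
  have "set zs \<subseteq> verts G"
  proof
    fix z assume "z \<in> set zs"
    then obtain i where i: "i < length zs" "z = zs ! i"
      by (auto simp: in_set_conv_nth)
    have "(zs @ [hd zs]) ! i \<rightarrow>\<^bsub>G\<^esub> (zs @ [hd zs]) ! Suc i"
      using succ i by (intro successively_nth[where P = "\<lambda>u v. u \<rightarrow>\<^bsub>G\<^esub> v"]) auto
    then show "z \<in> verts G"
      using i adj_in_verts(1) by (auto simp: nth_append)
  qed
  then have "set (zs @ [hd zs]) \<subseteq> verts G"
    using zs by auto
  then obtain p where p: "awalk (hd zs) p (hd zs)" "awalk_verts (hd zs) p = zs @ [hd zs]"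
    using successively_dominates_awalk[OF succ] zs by auto
  have len: "length p = length zs"
    using p(2) length_awalk_verts[of "hd zs" p] by simp
  moreover have "distinct (tl (awalk_verts (hd zs) p))"
    using zs p(2) by (cases zs) auto
  ultimately show ?thesis
    using p(1) zs by (intro exI[of _ p]) (auto simp: ucycle_def cycle_def)
qed

lemma (in nomulti_digraph) out_degree_eq_card_dominated:
  "out_degree G u = card {v. u \<rightarrow>\<^bsub>G\<^esub> v}"
proof -
  have "inj_on (head G) (out_arcs G u)"
    by (rule inj_onI) (auto intro!: no_multi_arcs simp: arc_to_ends_def)
  moreover have "head G ` out_arcs G u = {v. u \<rightarrow>\<^bsub>G\<^esub> v}"
    by (auto simp: arcs_ends_def arc_to_ends_def)
  ultimately show ?thesis
    unfolding out_degree_def by (metis card_image)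
qed

theorem theorem18:
  fixes G :: "('a, 'b) pre_digraph"
  assumes "G \<in> epsilon12"
  shows "\<exists>v \<in> verts G. out_degree G v = 2"
proof (rule ccontr)
  assume no2: "\<not> ?thesis"
  have "graph G" and con: "connected G" and ev: "\<And>v. v \<in> verts G \<Longrightarrow> even (out_degree G v)"
    and type12: "\<And>p. ucycle G p \<Longrightarrow> length p mod 4 \<in> {1, 2}"
    and "\<exists>p. ucycle G p"
    using assms by (auto simp: epsilon12_def euler_graph_def cycle_of_type_def)
  interpret graph G by fact
  obtain p where "ucycle G p" using \<open>\<exists>p. ucycle G p\<close> by blast
  then obtain e where e: "e \<in> arcs G"
    by (cases p) (auto simp: ucycle_def cycle_def awalk_Cons_iff)
  \<comment> \<open>Degree 0 is even and must be ruled out separately: some end of \<open>e\<close>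
    differs from \<open>u\<close>, and a walk from \<open>u\<close> to it starts with an
    arc.\<close>
  have pos: "\<exists>v. u \<rightarrow>\<^bsub>G\<^esub> v" if u: "u \<in> verts G" for u
  proof -
    obtain w where w: "w \<in> verts G" "w \<noteq> u"
      using e no_loops[OF e] head_in_verts tail_in_verts by metis
    have "u \<rightarrow>\<^sup>*\<^bsub>G\<^esub> w"
      using symmetric_connected_imp_strongly_connected[OF sym_arcs con] u w by auto
    then show ?thesis
      using w(2) by (metis converse_reachable_cases)
  qed
  let ?E = "\<lambda>u v. u \<rightarrow>\<^bsub>G\<^esub> v"
  have deg: "\<exists>x. ?E u x \<and> x \<noteq> v \<and> x \<noteq> w" if u: "u \<in> verts G" for u v w
  proof (rule ccontr)
    assume *: "\<not> ?thesis"
    then have sub: "{x. ?E u x} \<subseteq> {v, w}" by auto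
    have "card {x. ?E u x} \<le> card {v, w}"
      using sub by (intro card_mono) auto
    also have "\<dots> \<le> 2"
      by (simp add: card_insert_if)
    \<comment> \<open>Evenness excludes degree 1, \<open>pos\<close> excludes 0 and
      \<open>no2\<close> excludes 2.\<close>
    finally have "out_degree G u \<le> 2"
      by (simp add: out_degree_eq_card_dominated)
    moreover have "out_degree G u \<noteq> 0"
      using pos[OF u] finite_subset[OF sub] by (auto simp: out_degree_eq_card_dominated)
    ultimately show False
      using ev[OF u] no2 u by (metis One_nat_def le_antisym le_Suc_eq numeral_2_eq_2 le_zero_eq odd_one)
  qed
  have "symp ?E"
    using sym_arcs by (auto simp: symmetric_def intro: sympI dest: symD)
  moreover have "irreflp ?E"
    by (auto intro!: irreflpI dest: adj_not_same)
  moreover have "verts G \<noteq> {}"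
    using e tail_in_verts by blast
  ultimately obtain zs where "vertex_cycle ?E zs" "length zs mod 4 \<notin> {1, 2}"
    using min_degree_3_cycle_mod_4[of ?E "verts G"] deg adj_in_verts(2) finite_verts by blast
  then show False
    using vertex_cycle_ucycle type12 by metis
qed

end
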